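(* Let $n\geqslant 3$. Let $\vec{k}=(k_1,\ldots,k_n)\in\mathbb{Z}^n$ with $k_i>0$ and $k_i\neq k_j$ for $i\neq j$, and let $\vec{h}\in\mathbb{N}^n$ with $1\leqslant h_1\leqslant\cdots\leqslant h_n$. Let $A$ be a real number and let $\vec{a}\in\mathbb{Z}^n$ satisfy $0<|a_i|\leqslant A$ for $i=1,\ldots,n$. Then for any (finite, nonempty) set of primes $\mathcal{Q}$, $$\frac{1}{\#\mathcal{Q}}\sum_{q\in\mathcal{Q}}\#\mathcal{U}_{n,q}(\vec{a},\vec{k},\vec{h})\ll h_3\exp\left(O\left(\frac{\log A}{\log\log A}+\log\log h_3\right)\right)+\frac{h_1h_2h_3\log h_3}{\#\mathcal{Q}\,\log\log h_3},$$ where the implied constants depend only on $n$ and $\vec{k}$.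
   Context: For a prime $q$, $\mathbb{F}_q$ is identified with $\{0,1,\ldots,q-1\}$ and $\|\zeta\|$ is the distance from a real $\zeta$ to the nearest integer. $\mathcal{U}_{n,q}(\vec{a},\vec{k},\vec{h})$ denotes the set of $u\in\mathbb{F}_q$ for which the Bohr set $\{s\in\mathbb{F}_q:\ \|a_j u^{k_j} s/q\|\leqslant h_j/q,\ j=1,\ldots,n\}$ contains some $s\neq0$; equivalently, the set of $u\in\mathbb{F}_q$ for which there exist $s\in\{1,\ldots,q-1\}$ and integers $x_j$, $|x_j|\leqslant h_j$, with $s a_j u^{k_j}\equiv x_j\pmod q$ for all $j$.
   Formalization: It is additionally assumed that each prime q in Q divides at most one of a_1, a_2, a_3 (otherwise, e.g. a=(q,q,q), A=q, Q={q}, the bound fails), and log is read as max(1, ln) so that log log A and log log h_3 are defined and positive. *)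

theory Defs
  imports Complex_Main "HOL-Computational_Algebra.Primes"
begin

definition dist_nearest_int :: "real \<Rightarrow> real" where
  "dist_nearest_int x = \<bar>x - of_int (round x)\<bar>"

text \<open>
  Vectors with \<open>n\<close> components are functions on \<open>nat\<close>, of which only the values at the indices
  \<open>1, \<dots>, n\<close> matter. The field with \<open>q\<close> elements is the set \<open>{0..<q}\<close>.
\<close>

definition bohr_set ::
  "nat \<Rightarrow> nat \<Rightarrow> (nat \<Rightarrow> int) \<Rightarrow> (nat \<Rightarrow> nat) \<Rightarrow> (nat \<Rightarrow> nat) \<Rightarrow> nat \<Rightarrow> nat set" where
  "bohr_set n q a k h u =
     {s \<in> {0..<q}. \<forall>j\<in>{1..n}.
        dist_nearest_int (of_int (a j) * of_nat u ^ k j * of_nat s / of_nat q)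
          \<le> of_nat (h j) / of_nat q}"

text \<open>
  If \<open>n = 3\<close> and \<open>q\<close> divides two of the \<open>a j\<close>, then the set below is all of \<open>{0..<q}\<close>, whatever the
  size of the \<open>h j \<ge> 1\<close>: the two corresponding conditions are void, and the third one can be met
  by a suitable \<open>s \<noteq> 0\<close>. Non-trivial upper bounds for its cardinality must exclude this.
\<close>

definition bohr_params ::
  "nat \<Rightarrow> nat \<Rightarrow> (nat \<Rightarrow> int) \<Rightarrow> (nat \<Rightarrow> nat) \<Rightarrow> (nat \<Rightarrow> nat) \<Rightarrow> nat set" where
  "bohr_params n q a k h = {u \<in> {0..<q}. \<exists>s\<in>bohr_set n q a k h u. s \<noteq> 0}"

text \<open>
  The usual convention for iterated logarithms in bounds with implied constants: the logarithm is
  bounded below by 1, so that \<open>log log x\<close> is defined and positive for small \<open>x\<close> as well. The iterate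
  \<open>log1 (log1 x)\<close> is \<open>ln (ln x)\<close> as soon as \<open>ln (ln x) \<ge> 1\<close>.
\<close>

definition log1 :: "real \<Rightarrow> real" where
  "log1 x = max 1 (ln x)"

end

theory Submission
  imports Defs "HOL-Analysis.Harmonic_Numbers" "HOL-Number_Theory.Residues"
begin

text \<open>
  Only the first three indices matter; order them so that \<open>k\<^sub>i < k\<^sub>j < k\<^sub>l\<close>. If \<open>u \<noteq> 0\<close> lies in
  the set for \<open>q\<close>, then \<open>a\<^sub>v u\<^bsup>k\<^sub>v\<^esup> s \<equiv> x\<^sub>v\<close> modulo \<open>q\<close> with \<open>\<bar>x\<^sub>v\<bar> \<le> h\<^sub>v\<close>. Eliminating \<open>s\<close> from two of
  these congruences bounds the number of \<open>u\<close> that belong to given \<open>x\<^sub>v\<close> and \<open>x\<^sub>w\<close>, so that the set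
  always has \<open>O(h\<^sub>2 h\<^sub>3)\<close> elements. Write \<open>M = log h\<^sub>3\<close>. If \<open>log A \<ge> M log M\<close>, then
  \<open>h\<^sub>3 \<le> exp (2 log A / log log A)\<close> and this suffices.

  Otherwise, eliminating \<open>s\<close> and \<open>u\<close> from all three shows that \<open>q\<close> divides the value \<open>F(x)\<close> of a
  form that does not depend on \<open>q\<close>. Primes \<open>q \<le> h\<^sub>3\<close> are handled by the trivial bound \<open>q\<close>. A value
  \<open>F(x) \<noteq> 0\<close> has \<open>O(log (A h\<^sub>3) / M) = O(log M)\<close> prime factors \<open>q > h\<^sub>3\<close>, and likewise few \<open>q > h\<^sub>3\<close>
  divide \<open>a\<^sub>1 a\<^sub>2 a\<^sub>3\<close>. If \<open>F(x) = 0\<close>, then \<open>x\<^sub>i / x\<^sub>l\<close> is an \<open>e\<close>-th power, \<open>e \<ge> 2\<close>, times a constant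
  that depends on \<open>a\<close> only; there are \<open>O(h\<^sub>3 log h\<^sub>3)\<close> such pairs, uniformly in the constant.
\<close>

section \<open>Pairs whose ratio is a perfect power up to a constant factor\<close>

lemma card_eq_sum_card_Image:
  assumes "finite A" "finite R" "Domain R \<subseteq> A"
  shows "card R = (\<Sum>x\<in>A. card (R `` {x}))"
proof -
  have "R = (SIGMA x:A. R `` {x})"
    using assms(3) by auto
  moreover have "finite (R `` {x})" for x
    using assms(2) by (auto intro: finite_subset[of _ "Range R"] finite_Range)
  ultimately show ?thesis
    using assms(1) card_SigmaI by metis
qed

lemma card_le_card_relcomp_converse_if_degree_le:
  assumes "finite P" "S \<subseteq> P"
    and degree: "\<And>x y. (x, y) \<in> S \<Longrightarrow> card (P `` {x}) \<le> card (P\<inverse> `` {y})"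
  shows "card S \<le> card (P O P\<inverse>)"
proof -
  have fin: "finite (S `` {x})" "finite ((P O P\<inverse>) `` {x})" for x
    using assms(1,2) by (auto intro: finite_subset[of "S `` {x}" "Range P"] finite_Range)
  have "card (S `` {x}) \<le> card ((P O P\<inverse>) `` {x})" for x
  proof (cases "S `` {x} = {}")
    case False
    then obtain y where y: "(x, y) \<in> S" by blast
    have "card (S `` {x}) \<le> card (P `` {x})"
      using assms(1,2) by (intro card_mono) auto
    also have "\<dots> \<le> card (P\<inverse> `` {y})"
      using y by (rule degree)
    also have "\<dots> \<le> card ((P O P\<inverse>) `` {x})"
      using y assms(2) fin by (intro card_mono) auto
    finally show ?thesis .
  qed simp
  then have "(\<Sum>x\<in>Domain P. card (S `` {x})) \<le> (\<Sum>x\<in>Domain P. card ((P O P\<inverse>) `` {x}))"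
    by (intro sum_mono)
  moreover have "Domain S \<subseteq> Domain P" "Domain (P O P\<inverse>) \<subseteq> Domain P"
    using assms(2) by auto
  ultimately show ?thesis
    using assms finite_subset[OF assms(2,1)]
    by (simp add: card_eq_sum_card_Image[of "Domain P"] finite_Domain finite_relcomp)
qed

lemma card_le_card_relcomp_converse:
  assumes "finite P"
  shows "card P \<le> card (P O P\<inverse>) + card (P\<inverse> O P)"
proof -
  define S where "S = {(x, y) \<in> P. card (P `` {x}) \<le> card (P\<inverse> `` {y})}"
  have "S \<subseteq> P" by (auto simp: S_def)
  have "card S \<le> card (P O P\<inverse>)"
    using assms by (rule card_le_card_relcomp_converse_if_degree_le) (auto simp: S_def)
  moreover have "card ((P - S)\<inverse>) \<le> card (P\<inverse> O (P\<inverse>)\<inverse>)"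
    using assms by (intro card_le_card_relcomp_converse_if_degree_le) (auto simp: S_def)
  moreover have "card P \<le> card S + card (P - S)"
    using card_Un_le[of S "P - S"] \<open>S \<subseteq> P\<close> by (simp add: Un_absorb1)
  ultimately show ?thesis by simp
qed

lemma power_eq_power_imp_perfect_power:
  fixes z w :: "'a :: linordered_field"
  assumes eq: "z ^ m = w ^ n" and "n > 0" "z > 0" "w > 0"
  shows "\<exists>t>0. w = t ^ (m div gcd m n)"
proof -
  have "gcd m n > 0" using \<open>n > 0\<close> by simp
  then obtain m' n' where mn: "m = m' * gcd m n" "n = n' * gcd m n" "coprime m' n'"
    using gcd_coprime_exists[of m n] by blast
  have "(z ^ m') ^ gcd m n = (w ^ n') ^ gcd m n"
    using eq mn(1,2) by (metis power_mult)
  then have zw: "z ^ m' = w ^ n'"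
    using \<open>gcd m n > 0\<close> assms by (subst (asm) power_eq_iff_eq_base) auto
  have "n' \<noteq> 0" using \<open>n > 0\<close> mn(2) by (metis less_irrefl mult_0)
  then obtain x y where "n' * x = m' * y + 1"
    using bezout_nat[of n' m'] mn(3) by (auto simp: coprime_iff_gcd_eq_1 gcd.commute[of n'])
  then have "w * (w ^ y) ^ m' = w ^ (n' * x)"
    by (simp add: mult.commute flip: power_mult)
  also have "\<dots> = (z ^ x) ^ m'"
    by (metis zw mult.commute power_mult)
  finally have "w = (z ^ x / w ^ y) ^ m'"
    using \<open>w > 0\<close> by (simp add: power_divide field_simps)
  moreover have "m div gcd m n = m'"
    using mn(1) \<open>gcd m n > 0\<close> by (metis less_irrefl nonzero_mult_div_cancel_right)
  ultimately show ?thesis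
    using assms by (intro exI[of _ "z ^ x / w ^ y"]) auto
qed

lemma div_gcd_ge_2:
  fixes m n :: nat
  assumes "0 < n" "n < m"
  shows "m div gcd m n \<ge> 2"
proof -
  obtain d where d: "m = gcd m n * d" by (metis dvd_def gcd_dvd1)
  have "gcd m n < m" using gcd_le2_nat[of n m] assms by linarith
  with d have "d \<noteq> 0" "d \<noteq> 1" by (metis mult_0_right not_less0, metis mult_1_right less_irrefl)
  moreover have "m div gcd m n = d"
    using d assms by (metis gcd_eq_0_iff less_nat_zero_code nonzero_mult_div_cancel_left)
  ultimately show ?thesis by simp
qed

lemma power_ratio_common_factor:
  fixes x y :: nat and t :: rat
  assumes eq: "of_nat x = of_nat y * t ^ e" and "t > 0"
  obtains g p r where "p > 0" "r > 0" "x = g * p ^ e" "y = g * r ^ e"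
proof -
  obtain P R where t: "t = Fract P R" "R > 0" "coprime P R" by (rule Rat_cases)
  with \<open>t > 0\<close> have "P > 0" by (simp add: zero_less_Fract_iff)
  define p r where "p = nat P" and "r = nat R"
  have pr: "p > 0" "r > 0" "coprime p r" "t = of_nat p / of_nat r"
    using t \<open>P > 0\<close> by (auto simp: p_def r_def Fract_of_int_quotient simp flip: coprime_int_iff)
  have "of_nat (x * r ^ e) = (of_nat (y * p ^ e) :: rat)"
    using eq pr by (simp add: power_divide field_simps)
  then have xy: "x * r ^ e = y * p ^ e"
    using of_nat_eq_iff by blast
  then have "r ^ e dvd y * p ^ e"
    by (metis dvd_triv_right)
  then have "r ^ e dvd y"
    using pr(3) by (simp add: coprime_dvd_mult_left_iff coprime_commute)
  then obtain g where g: "y = r ^ e * g" by (elim dvdE)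
  with xy pr(2) have "x = g * p ^ e" by simp
  with that pr g show thesis by (simp add: mult.commute)
qed

lemma finite_power_mult_le: "finite {p. 0 < p \<and> g * p ^ e \<le> h}"
  and card_power_mult_le: "(real (card {p. 0 < p \<and> g * p ^ e \<le> h}))\<^sup>2 \<le> real h / real g"
  if "g > 0" "e \<ge> 2" for g h :: nat
proof -
  have "p \<le> nat \<lfloor>sqrt (real h / real g)\<rfloor>" if p: "0 < p" "g * p ^ e \<le> h" for p
  proof -
    have "g * p\<^sup>2 \<le> g * p ^ e"
      using p(1) \<open>e \<ge> 2\<close> by (intro mult_left_mono power_increasing) auto
    with p(2) have "real (g * p\<^sup>2) \<le> real h"
      by (meson le_trans of_nat_mono)
    then have "(real p)\<^sup>2 \<le> real h / real g"
      using \<open>g > 0\<close> by (simp add: field_simps)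
    then show ?thesis
      by (simp add: le_nat_iff le_floor_iff real_le_rsqrt)
  qed
  then have sub: "{p. 0 < p \<and> g * p ^ e \<le> h} \<subseteq> {0<..nat \<lfloor>sqrt (real h / real g)\<rfloor>}"
    by auto
  then show "finite {p. 0 < p \<and> g * p ^ e \<le> h}"
    by (rule finite_subset) simp
  have "card {p. 0 < p \<and> g * p ^ e \<le> h} \<le> nat \<lfloor>sqrt (real h / real g)\<rfloor>"
    using card_mono[OF _ sub] by simp
  also have "real \<dots> \<le> sqrt (real h / real g)" by simp
  finally have "(real (card {p. 0 < p \<and> g * p ^ e \<le> h}))\<^sup>2 \<le> (sqrt (real h / real g))\<^sup>2"
    by (intro power_mono) auto
  then show "(real (card {p. 0 < p \<and> g * p ^ e \<le> h}))\<^sup>2 \<le> real h / real g" by simp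
qed

definition power_ratio_pairs :: "nat \<Rightarrow> rat \<Rightarrow> nat \<Rightarrow> (nat \<times> nat) set" where
  "power_ratio_pairs e c h =
     {(x, y). x \<in> {1..h} \<and> y \<in> {1..h} \<and> (\<exists>t>0. of_nat x = c * of_nat y * t ^ e)}"

lemma finite_power_ratio_pairs [simp]: "finite (power_ratio_pairs e c h)"
  by (rule finite_subset[of _ "{1..h} \<times> {1..h}"]) (auto simp: power_ratio_pairs_def)

lemma power_ratio_pairs_1_subset:
  "power_ratio_pairs e 1 h \<subseteq> (\<lambda>(g, p, r). (g * p ^ e, g * r ^ e)) `
     (SIGMA g:{1..h}. {p. 0 < p \<and> g * p ^ e \<le> h} \<times> {r. 0 < r \<and> g * r ^ e \<le> h})"
proof clarify
  fix x y assume "(x, y) \<in> power_ratio_pairs e 1 h"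
  then obtain t :: rat where xy: "x \<in> {1..h}" "y \<in> {1..h}"
    and t: "of_nat x = of_nat y * t ^ e" "t > 0"
    by (auto simp: power_ratio_pairs_def)
  obtain g p r where gpr: "p > 0" "r > 0" "x = g * p ^ e" "y = g * r ^ e"
    using t by (rule power_ratio_common_factor)
  have "g \<noteq> 0" "g \<le> x" using xy(1) gpr(1,3) by (auto intro: ccontr)
  with xy(1) have "g \<in> {1..h}" by simp
  with xy gpr show "(x, y) \<in> (\<lambda>(g, p, r). (g * p ^ e, g * r ^ e)) `
      (SIGMA g:{1..h}. {p. 0 < p \<and> g * p ^ e \<le> h} \<times> {r. 0 < r \<and> g * r ^ e \<le> h})"
    by (intro image_eqI[of _ _ "(g, p, r)"]) auto
qed

lemma card_power_ratio_pairs_1_le: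
  assumes "e \<ge> 2" "h \<ge> 1"
  shows "real (card (power_ratio_pairs e 1 h)) \<le> real h * (1 + ln (real h))"
proof -
  let ?B = "\<lambda>g. {p. 0 < p \<and> g * p ^ e \<le> h}"
  have "card (power_ratio_pairs e 1 h) \<le> card (SIGMA g:{1..h}. ?B g \<times> ?B g)"
    using assms(1) by (intro surj_card_le[OF _ power_ratio_pairs_1_subset])
      (auto intro!: finite_SigmaI finite_power_mult_le)
  also have "\<dots> = (\<Sum>g=1..h. (card (?B g))\<^sup>2)"
    using assms(1) by (subst card_SigmaI)
      (auto intro!: finite_power_mult_le simp: card_cartesian_product power2_eq_square)
  finally have "real (card (power_ratio_pairs e 1 h)) \<le> (\<Sum>g=1..h. (real (card (?B g)))\<^sup>2)"
    by (simp flip: of_nat_power of_nat_sum)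
  also have "\<dots> \<le> (\<Sum>g=1..h. real h / real g)"
    using assms(1) by (intro sum_mono card_power_mult_le) auto
  also have "\<dots> = real h * harm h"
    by (simp add: harm_def sum_distrib_left field_simps)
  also have "\<dots> \<le> real h * (1 + ln (real h))"
    using euler_mascheroni_sequence_decreasing[of 1 h] assms(2)
    by (intro mult_left_mono) (auto simp: harm_expand)
  finally show ?thesis .
qed

text \<open>
  Two numbers that match a common one differ by an \<open>e\<close>-th power, which reduces the count to \<open>c = 1\<close>.
\<close>

lemma card_power_ratio_pairs_le:
  assumes "c > 0"
  shows "card (power_ratio_pairs e c h) \<le> 2 * card (power_ratio_pairs e 1 h)"
proof -
  let ?P = "power_ratio_pairs e c h" and ?R = "power_ratio_pairs e 1 h"
  have ratio: "(x, y) \<in> ?R" if "x \<in> {1..h}" "y \<in> {1..h}" "s > 0" "t > 0"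
    "of_nat x * t ^ e = of_nat y * s ^ e" for x y and s t :: rat
    using that by (auto simp: power_ratio_pairs_def power_divide field_simps
        intro!: exI[of _ "s / t"])
  have "(x, x') \<in> ?R" if "(x, y) \<in> ?P" "(x', y) \<in> ?P" for x x' y
  proof -
    from that obtain s t where "s > 0" "t > 0" "of_nat x = c * of_nat y * s ^ e"
      "of_nat x' = c * of_nat y * t ^ e" "x \<in> {1..h}" "x' \<in> {1..h}"
      by (auto simp: power_ratio_pairs_def)
    then show ?thesis
      by (intro ratio[of _ _ s t]) auto
  qed
  then have "?P O ?P\<inverse> \<subseteq> ?R" by blast
  moreover have "(y, y') \<in> ?R" if "(x, y) \<in> ?P" "(x, y') \<in> ?P" for x y y'
  proof -
    from that obtain s t where st: "s > 0" "t > 0" "of_nat x = c * of_nat y * s ^ e"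
      "of_nat x = c * of_nat y' * t ^ e" "y \<in> {1..h}" "y' \<in> {1..h}"
      by (auto simp: power_ratio_pairs_def)
    then have "c * (of_nat y * s ^ e) = c * (of_nat y' * t ^ e)"
      by (metis mult.assoc)
    then show ?thesis
      using st assms by (intro ratio[of _ _ t s]) auto
  qed
  then have "?P\<inverse> O ?P \<subseteq> ?R" by blast
  ultimately have "card (?P O ?P\<inverse>) \<le> card ?R" "card (?P\<inverse> O ?P) \<le> card ?R"
    by (auto intro: card_mono)
  with card_le_card_relcomp_converse[of ?P] show ?thesis by simp
qed

section \<open>Eliminating the parameters from a system of congruences\<close>

lemma cong_eliminate_pair:
  fixes q :: "'a :: unique_euclidean_ring"
  assumes x1: "[a1 * u ^ k1 * s = x1] (mod q)" and x2: "[a2 * u ^ k2 * s = x2] (mod q)"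
    and "k1 \<le> k2"
  shows "[(a2 * x1) * u ^ (k2 - k1) = a1 * x2] (mod q)"
proof -
  have "[(a2 * x1) * u ^ (k2 - k1) = (a2 * (a1 * u ^ k1 * s)) * u ^ (k2 - k1)] (mod q)"
    using x1 by (intro cong_mult cong_refl) (rule cong_sym)
  also have "(a2 * (a1 * u ^ k1 * s)) * u ^ (k2 - k1) = a1 * (a2 * (u ^ k1 * u ^ (k2 - k1)) * s)"
    by (simp only: mult_ac)
  also have "u ^ k1 * u ^ (k2 - k1) = u ^ k2"
    using \<open>k1 \<le> k2\<close> by (simp flip: power_add)
  also have "[a1 * (a2 * u ^ k2 * s) = a1 * x2] (mod q)"
    using x2 by (intro cong_mult cong_refl)
  finally show ?thesis .
qed

definition triple_form ::
  "nat \<Rightarrow> nat \<Rightarrow> 'a \<times> 'a \<times> 'a \<Rightarrow> 'a \<times> 'a \<times> 'a \<Rightarrow> 'a :: comm_ring_1" where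
  "triple_form \<alpha> \<beta> = (\<lambda>(a1, a2, a3) (x1, x2, x3).
     x2 ^ (\<alpha> + \<beta>) * a1 ^ \<beta> * a3 ^ \<alpha> - a2 ^ (\<alpha> + \<beta>) * x1 ^ \<beta> * x3 ^ \<alpha>)"

lemma dvd_triple_form:
  fixes q :: "'a :: unique_euclidean_ring"
  assumes x: "[a1 * u ^ k1 * s = x1] (mod q)" "[a2 * u ^ k2 * s = x2] (mod q)"
      "[a3 * u ^ k3 * s = x3] (mod q)"
    and "k2 = k1 + \<alpha>" "k3 = k2 + \<beta>"
  shows "q dvd triple_form \<alpha> \<beta> (a1, a2, a3) (x1, x2, x3)"
proof -
  define w where "w k = u ^ k * s" for k
  have v: "[x1 = a1 * w k1] (mod q)" "[x2 = a2 * w k2] (mod q)" "[x3 = a3 * w k3] (mod q)"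
    using x[THEN cong_sym] by (simp_all add: w_def mult.assoc)
  have "k2 * (\<alpha> + \<beta>) = k1 * \<beta> + k3 * \<alpha>"
    unfolding assms(4,5) by (simp add: algebra_simps)
  then have "w k2 ^ (\<alpha> + \<beta>) = w k1 ^ \<beta> * w k3 ^ \<alpha>"
    unfolding w_def power_mult_distrib power_mult[symmetric] by (simp add: power_add)
  then have w: "(a2 * w k2) ^ (\<alpha> + \<beta>) * a1 ^ \<beta> * a3 ^ \<alpha>
      = a2 ^ (\<alpha> + \<beta>) * (a1 * w k1) ^ \<beta> * (a3 * w k3) ^ \<alpha>"
    by (simp only: power_mult_distrib mult_ac)
  have "[x2 ^ (\<alpha> + \<beta>) * a1 ^ \<beta> * a3 ^ \<alpha> = (a2 * w k2) ^ (\<alpha> + \<beta>) * a1 ^ \<beta> * a3 ^ \<alpha>] (mod q)"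
    by (intro cong_mult cong_pow cong_refl v)
  also note w
  also have "[a2 ^ (\<alpha> + \<beta>) * (a1 * w k1) ^ \<beta> * (a3 * w k3) ^ \<alpha>
      = a2 ^ (\<alpha> + \<beta>) * x1 ^ \<beta> * x3 ^ \<alpha>] (mod q)"
    by (intro cong_mult cong_pow cong_refl cong_sym[OF v(1)] cong_sym[OF v(3)])
  finally show ?thesis
    by (simp add: triple_form_def cong_iff_dvd_diff)
qed

lemma abs_triple_form_le:
  fixes A M :: "'a :: linordered_idom"
  assumes "\<bar>a1\<bar> \<le> A" "\<bar>a2\<bar> \<le> A" "\<bar>a3\<bar> \<le> A" and "\<bar>x1\<bar> \<le> M" "\<bar>x2\<bar> \<le> M" "\<bar>x3\<bar> \<le> M"
  shows "\<bar>triple_form \<alpha> \<beta> (a1, a2, a3) (x1, x2, x3)\<bar> \<le> 2 * (A * M) ^ (\<alpha> + \<beta>)"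
proof -
  have "\<bar>x2 ^ (\<alpha> + \<beta>) * a1 ^ \<beta> * a3 ^ \<alpha>\<bar> \<le> M ^ (\<alpha> + \<beta>) * A ^ \<beta> * A ^ \<alpha>"
    unfolding abs_mult power_abs using assms by (intro mult_mono power_mono) auto
  moreover have "\<bar>a2 ^ (\<alpha> + \<beta>) * x1 ^ \<beta> * x3 ^ \<alpha>\<bar> \<le> A ^ (\<alpha> + \<beta>) * M ^ \<beta> * M ^ \<alpha>"
    unfolding abs_mult power_abs using assms by (intro mult_mono power_mono) auto
  ultimately show ?thesis
    unfolding triple_form_def by (simp add: power_add power_mult_distrib mult_ac)
qed

lemma triple_form_eq_0_imp_perfect_power:
  fixes a1 a2 a3 x1 x2 x3 :: "'a :: linordered_field"
  assumes zero: "triple_form \<alpha> \<beta> (a1, a2, a3) (x1, x2, x3) = 0" and "\<beta> > 0"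
    and pos: "a1 > 0" "a2 > 0" "a3 > 0" "x1 > 0" "x2 > 0" "x3 > 0"
  shows "\<exists>t>0. x1 = a1 / a3 * x3 * t ^ ((\<alpha> + \<beta>) div gcd (\<alpha> + \<beta>) \<beta>)"
proof -
  have "((x2 / a2) / (x3 / a3)) ^ (\<alpha> + \<beta>) = ((x1 / a1) / (x3 / a3)) ^ \<beta>"
    using zero pos
    by (simp add: triple_form_def power_divide power_mult_distrib power_add field_simps)
  then obtain t where "t > 0" "(x1 / a1) / (x3 / a3) = t ^ ((\<alpha> + \<beta>) div gcd (\<alpha> + \<beta>) \<beta>)"
    using power_eq_power_imp_perfect_power \<open>\<beta> > 0\<close> pos by (metis divide_pos_pos)
  then show ?thesis
    using pos by (intro exI[of _ t]) (simp add: field_simps)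
qed

definition punctured_interval :: "nat \<Rightarrow> int set" where
  "punctured_interval m = {- int m..int m} - {0}"

lemma in_punctured_interval_iff: "x \<in> punctured_interval m \<longleftrightarrow> x \<noteq> 0 \<and> \<bar>x\<bar> \<le> int m"
  by (auto simp: punctured_interval_def)

lemma finite_punctured_interval [simp]: "finite (punctured_interval m)"
  and card_punctured_interval [simp]: "card (punctured_interval m) = 2 * m"
  by (simp_all add: punctured_interval_def card_Diff_singleton)

lemma card_signed_pairs_le:
  fixes S :: "(int \<times> int) set"
  assumes "finite P" "\<And>x y. (x, y) \<in> S \<Longrightarrow> (nat \<bar>x\<bar>, nat \<bar>y\<bar>) \<in> P"
  shows "card S \<le> 4 * card P"
proof -
  let ?signed = "\<lambda>(p, r). {int p, - int p} \<times> {int r, - int r}"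
  have "S \<subseteq> (\<Union>z\<in>P. ?signed z)"
    using assms(2) by (force simp: abs_if split: if_splits)
  then have "card S \<le> card (\<Union>z\<in>P. ?signed z)"
    using assms(1) by (intro card_mono) auto
  also have "\<dots> \<le> (\<Sum>z\<in>P. card (?signed z))"
    using assms(1) by (rule card_UN_le)
  also have "\<dots> \<le> (\<Sum>z\<in>P. 4)"
    by (intro sum_mono) (auto simp: card_cartesian_product card_insert_if)
  finally show ?thesis by simp
qed

lemma card_triple_form_zeros_le:
  fixes a1 a2 a3 :: int
  assumes "\<alpha> > 0" "\<beta> > 0" "a1 \<noteq> 0" "a2 \<noteq> 0" "a3 \<noteq> 0" "m \<ge> 1"
  defines "Z \<equiv> {(x1, x3) \<in> punctured_interval m \<times> punctured_interval m.
    \<exists>x2. x2 \<noteq> 0 \<and> triple_form \<alpha> \<beta> (a1, a2, a3) (x1, x2, x3) = 0}"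
  shows "real (card Z) \<le> 8 * (real m * (1 + ln (real m)))"
proof -
  define e where "e = (\<alpha> + \<beta>) div gcd (\<alpha> + \<beta>) \<beta>"
  define rat_abs :: "int \<Rightarrow> rat" where "rat_abs v = of_int \<bar>v\<bar>" for v
  have rat_abs_pos: "rat_abs v > 0" if "v \<noteq> 0" for v using that by (simp add: rat_abs_def)
  have "(nat \<bar>x1\<bar>, nat \<bar>x3\<bar>) \<in> power_ratio_pairs e (rat_abs a1 / rat_abs a3) m"
    if "(x1, x3) \<in> Z" for x1 x3
  proof -
    from that obtain x2 where x: "x1 \<noteq> 0" "x2 \<noteq> 0" "x3 \<noteq> 0" "\<bar>x1\<bar> \<le> int m" "\<bar>x3\<bar> \<le> int m"
      and "triple_form \<alpha> \<beta> (a1, a2, a3) (x1, x2, x3) = 0"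
      by (auto simp: Z_def in_punctured_interval_iff)
    then have "rat_abs (x2 ^ (\<alpha> + \<beta>) * a1 ^ \<beta> * a3 ^ \<alpha>) = rat_abs (a2 ^ (\<alpha> + \<beta>) * x1 ^ \<beta> * x3 ^ \<alpha>)"
      by (simp add: triple_form_def)
    then have zero: "triple_form \<alpha> \<beta> (rat_abs a1, rat_abs a2, rat_abs a3)
        (rat_abs x1, rat_abs x2, rat_abs x3) = 0"
      by (simp add: triple_form_def rat_abs_def abs_mult power_abs)
    then have "\<exists>t>0. rat_abs x1 = rat_abs a1 / rat_abs a3 * rat_abs x3 * t ^ e"
      using triple_form_eq_0_imp_perfect_power[OF zero] assms(2-5) x(1-3) rat_abs_pos
      by (simp add: e_def)
    moreover have "of_nat (nat \<bar>v\<bar>) = rat_abs v" for v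
      by (simp add: rat_abs_def)
    ultimately show ?thesis
      using x by (auto simp: power_ratio_pairs_def Suc_le_eq)
  qed
  then have "card Z \<le> 4 * card (power_ratio_pairs e (rat_abs a1 / rat_abs a3) m)"
    by (intro card_signed_pairs_le) auto
  also have "\<dots> \<le> 8 * card (power_ratio_pairs e 1 m)"
    using card_power_ratio_pairs_le[of "rat_abs a1 / rat_abs a3" e m] rat_abs_pos assms by simp
  finally have "real (card Z) \<le> 8 * real (card (power_ratio_pairs e 1 m))"
    by linarith
  also have "\<dots> \<le> 8 * (real m * (1 + ln (real m)))"
    using card_power_ratio_pairs_1_le[OF div_gcd_ge_2, of \<beta> "\<alpha> + \<beta>" m] assms
    by (simp add: e_def)
  finally show ?thesis .
qed

section \<open>Residues of a Bohr set\<close>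

definition bohr_residues ::
  "nat \<Rightarrow> nat \<Rightarrow> (nat \<Rightarrow> int) \<Rightarrow> (nat \<Rightarrow> nat) \<Rightarrow> (nat \<Rightarrow> nat) \<Rightarrow> nat \<Rightarrow> (nat \<Rightarrow> int) set" where
  "bohr_residues n q a k h u = {x. \<exists>s. \<not> int q dvd s \<and>
     (\<forall>j\<in>{1..n}. \<bar>x j\<bar> \<le> int (h j) \<and> [a j * int u ^ k j * s = x j] (mod int q))}"

lemma dist_nearest_int_le_imp_cong:
  assumes "q > 0" "dist_nearest_int (of_int N / of_nat q) \<le> real m / real q"
  obtains x where "\<bar>x\<bar> \<le> int m" "[N = x] (mod int q)"
proof
  let ?x = "N - int q * round (of_int N / real q)"
  have "real_of_int \<bar>?x\<bar> = real q * dist_nearest_int (of_int N / of_nat q)"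
    using assms(1) by (simp add: dist_nearest_int_def abs_mult[of "real q", symmetric, simplified]
        right_diff_distrib)
  also have "\<dots> \<le> real q * (real m / real q)"
    using assms by (intro mult_left_mono) auto
  also have "\<dots> = real_of_int (int m)"
    using assms(1) by simp
  finally show "\<bar>?x\<bar> \<le> int m"
    by (simp only: of_int_le_iff)
  show "[N = ?x] (mod int q)"
    by (simp add: cong_iff_dvd_diff)
qed

lemma bohr_residues_nonempty:
  assumes "u \<in> bohr_params n q a k h"
  shows "bohr_residues n q a k h u \<noteq> {}"
proof -
  from assms obtain s where s: "0 < s" "s < q" and
    dist: "\<And>j. j \<in> {1..n} \<Longrightarrow>
      dist_nearest_int (of_int (a j * int u ^ k j * int s) / of_nat q) \<le> real (h j) / real q"
    by (auto simp: bohr_params_def bohr_set_def)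
  have "\<forall>j\<in>{1..n}. \<exists>x. \<bar>x\<bar> \<le> int (h j) \<and> [a j * int u ^ k j * int s = x] (mod int q)"
    using dist_nearest_int_le_imp_cong[OF _ dist] s by (metis less_trans)
  then obtain x where
    "\<forall>j\<in>{1..n}. \<bar>x j\<bar> \<le> int (h j) \<and> [a j * int u ^ k j * int s = x j] (mod int q)"
    by (metis bchoice)
  moreover have "\<not> int q dvd int s"
    using s by (auto dest: dvd_imp_le)
  ultimately show ?thesis
    unfolding bohr_residues_def by blast
qed

lemma bohr_residues_not_dvd:
  assumes "x \<in> bohr_residues n q a k h u" "prime q" "\<not> q dvd u" "j \<in> {1..n}" "\<not> int q dvd a j"
  shows "\<not> int q dvd x j"
proof -
  obtain s where s: "\<not> int q dvd s" "[a j * int u ^ k j * s = x j] (mod int q)"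
    using assms(1,4) by (auto simp: bohr_residues_def)
  have "prime (int q)" using assms(2) by simp
  moreover from this have "\<not> int q dvd int u ^ k j"
    using assms(3) prime_dvd_power[of "int q" "int u"] by auto
  ultimately have "\<not> int q dvd a j * int u ^ k j * s"
    using assms(5) s(1) by (simp add: prime_dvd_mult_iff)
  then show ?thesis
    using s(2) cong_dvd_iff by blast
qed

lemma bohr_residues_in_punctured_interval:
  assumes "x \<in> bohr_residues n q a k h u" "prime q" "\<not> q dvd u" "j \<in> {1..n}" "\<not> int q dvd a j"
  shows "x j \<in> punctured_interval (h j)"
  using bohr_residues_not_dvd[OF assms] assms(1,4)
  by (auto simp: bohr_residues_def in_punctured_interval_iff)

lemma bohr_residues_pair_cong:
  assumes "x \<in> bohr_residues n q a k h u" "i \<in> {1..n}" "j \<in> {1..n}" "k i \<le> k j"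
  shows "[(a j * x i) * int u ^ (k j - k i) = a i * x j] (mod int q)"
proof -
  obtain s where "\<forall>j\<in>{1..n}. [a j * int u ^ k j * s = x j] (mod int q)"
    using assms(1) by (auto simp: bohr_residues_def)
  then show ?thesis
    using assms(2-4) by (intro cong_eliminate_pair[of _ _ _ s]) auto
qed

lemma bohr_residues_dvd_triple_form:
  assumes "x \<in> bohr_residues n q a k h u" "i \<in> {1..n}" "j \<in> {1..n}" "l \<in> {1..n}"
    and "k i \<le> k j" "k j \<le> k l"
  shows "int q dvd triple_form (k j - k i) (k l - k j) (a i, a j, a l) (x i, x j, x l)"
proof -
  obtain s where "\<forall>j\<in>{1..n}. [a j * int u ^ k j * s = x j] (mod int q)"
    using assms(1) by (auto simp: bohr_residues_def)
  then show ?thesis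
    using assms by (intro dvd_triple_form[of "a i" "int u" "k i" s]) auto
qed

lemma bohr_params_subset: "bohr_params n q a k h \<subseteq> {0..<q}"
  by (auto simp: bohr_params_def)

lemma card_bohr_params_le: "card (bohr_params n q a k h) \<le> q"
  using card_mono[OF finite_atLeastLessThan bohr_params_subset] by simp

lemma card_roots_mod_prime_le:
  fixes b c :: int
  assumes "prime q" "m > 0" "\<not> int q dvd b"
  shows "card {u \<in> {0..<q}. [b * int u ^ m = c] (mod int q)} \<le> m"
proof (cases "{u \<in> {0..<q}. [b * int u ^ m = c] (mod int q)} = {}")
  case False
  then obtain v where v: "[b * int v ^ m = c] (mod int q)" by blast
  have "[u ^ m = v ^ m] (mod q)" if "[b * int u ^ m = c] (mod int q)" for u
  proof -
    have "[b * int u ^ m = b * int v ^ m] (mod int q)"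
      using that v cong_sym cong_trans by blast
    moreover have "coprime b (int q)"
      using assms prime_imp_coprime[of "int q" b] by (simp add: coprime_commute)
    ultimately have "[int u ^ m = int v ^ m] (mod int q)"
      by (simp add: cong_mult_lcancel)
    then show ?thesis
      by (simp flip: cong_int_iff)
  qed
  then have "card {u \<in> {0..<q}. [b * int u ^ m = c] (mod int q)}
      \<le> card {u \<in> {..<q}. [u ^ m = v ^ m] (mod q)}"
    by (intro card_mono) auto
  also have "\<dots> \<le> m"
    using assms by (intro roots_mod_prime_bound)
  finally show ?thesis .
qed (simp only: card.empty)

lemma bohr_params_subset_roots:
  assumes "prime q" "\<not> int q dvd a i" and ij: "i \<in> {1..n}" "j \<in> {1..n}" "k i \<le> k j"
    and W: "\<And>u x. \<lbrakk>\<not> q dvd u; x \<in> bohr_residues n q a k h u\<rbrakk> \<Longrightarrow> (x i, x j) \<in> W"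
  shows "bohr_params n q a k h \<subseteq> insert 0 (\<Union>(v, w)\<in>{(v, w) \<in> W. \<not> int q dvd v}.
    {u \<in> {0..<q}. [(a j * v) * int u ^ (k j - k i) = a i * w] (mod int q)})"
proof
  fix u assume u: "u \<in> bohr_params n q a k h"
  show "u \<in> insert 0 (\<Union>(v, w)\<in>{(v, w) \<in> W. \<not> int q dvd v}.
    {u \<in> {0..<q}. [(a j * v) * int u ^ (k j - k i) = a i * w] (mod int q)})"
  proof (cases "u = 0")
    case False
    have "u < q" using u bohr_params_subset by fastforce
    with False have unit: "\<not> q dvd u" by (auto dest: dvd_imp_le)
    obtain x where x: "x \<in> bohr_residues n q a k h u"
      using bohr_residues_nonempty[OF u] by blast
    have "(x i, x j) \<in> W" "\<not> int q dvd x i"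
      using W[OF unit x] bohr_residues_not_dvd[OF x \<open>prime q\<close> unit ij(1)] assms(2) by auto
    moreover have "[(a j * x i) * int u ^ (k j - k i) = a i * x j] (mod int q)"
      using x ij by (rule bohr_residues_pair_cong)
    ultimately show ?thesis
      using \<open>u < q\<close> by (intro insertI2 UN_I[of "(x i, x j)"]) auto
  qed simp
qed

lemma card_bohr_params_le_mult_card:
  assumes q: "prime q" "\<not> int q dvd a i" "\<not> int q dvd a j"
    and ij: "i \<in> {1..n}" "j \<in> {1..n}" "k i < k j" and "finite W"
    and W: "\<And>u x. \<lbrakk>\<not> q dvd u; x \<in> bohr_residues n q a k h u\<rbrakk> \<Longrightarrow> (x i, x j) \<in> W"
  shows "card (bohr_params n q a k h) \<le> 1 + (k j - k i) * card W"
proof -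
  define V where "V = {(v, w) \<in> W. \<not> int q dvd v}"
  define roots where
    "roots v w = {u \<in> {0..<q}. [(a j * v) * int u ^ (k j - k i) = a i * w] (mod int q)}" for v w
  have "V \<subseteq> W" by (auto simp: V_def)
  with \<open>finite W\<close> have "finite V" by (rule rev_finite_subset)
  then have fin: "finite (\<Union>(v, w)\<in>V. roots v w)"
    by (auto simp: roots_def)
  have "bohr_params n q a k h \<subseteq> insert 0 (\<Union>(v, w)\<in>V. roots v w)"
    unfolding V_def roots_def using q ij W by (intro bohr_params_subset_roots) auto
  then have "card (bohr_params n q a k h) \<le> card (insert 0 (\<Union>(v, w)\<in>V. roots v w))"
    using fin by (intro card_mono) auto
  also have "\<dots> \<le> 1 + card (\<Union>(v, w)\<in>V. roots v w)"
    using fin by (simp add: card_insert_if)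
  also have "card (\<Union>(v, w)\<in>V. roots v w) \<le> (\<Sum>(v, w)\<in>V. card (roots v w))"
    using card_UN_le[OF \<open>finite V\<close>, of "\<lambda>(v, w). roots v w"] by (simp add: case_prod_unfold)
  also have "\<dots> \<le> (\<Sum>(v, w)\<in>V. k j - k i)"
  proof (intro sum_mono, clarify)
    fix v w assume "(v, w) \<in> V"
    then have "\<not> int q dvd a j * v"
      using q by (simp add: V_def prime_dvd_mult_iff)
    then show "card (roots v w) \<le> k j - k i"
      unfolding roots_def using q ij by (intro card_roots_mod_prime_le) auto
  qed
  also have "\<dots> \<le> (k j - k i) * card W"
    using card_mono[OF \<open>finite W\<close> \<open>V \<subseteq> W\<close>] by simp
  finally show ?thesis by simp
qed

lemma card_bohr_params_le_pair:
  assumes "prime q" "\<not> int q dvd a i" "\<not> int q dvd a j" "i \<in> {1..n}" "j \<in> {1..n}" "k i < k j"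
  shows "card (bohr_params n q a k h) \<le> 1 + (k j - k i) * (4 * (h i * h j))"
proof -
  have "card (bohr_params n q a k h)
      \<le> 1 + (k j - k i) * card (punctured_interval (h i) \<times> punctured_interval (h j))"
    using assms by (intro card_bohr_params_le_mult_card)
      (auto intro: bohr_residues_in_punctured_interval)
  then show ?thesis by (simp add: card_cartesian_product)
qed

section \<open>Truncated logarithms and large prime divisors\<close>

lemma log1_ge_1 [simp]: "log1 x \<ge> 1" and log1_pos [simp]: "log1 x > 0"
  and log1_nonneg [simp]: "log1 x \<ge> 0" and ln_le_log1: "ln x \<le> log1 x"
  by (auto simp: log1_def)

lemma mult_log1_le:
  assumes "M \<ge> 1" "M * log1 M \<le> L"
  shows "M * log1 L \<le> 2 * L"
proof -
  define v where "v = L / M"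
  have L: "L = M * v" and v: "v \<ge> log1 M"
    using assms by (auto simp: v_def field_simps)
  have "v \<ge> 1" using v log1_ge_1[of M] by linarith
  have "ln L = ln M + ln v"
    unfolding L using assms \<open>v \<ge> 1\<close> by (simp add: ln_mult)
  also have "\<dots> \<le> v + v"
    using v ln_le_log1[of M] ln_bound[of v] \<open>v \<ge> 1\<close> by linarith
  finally have "log1 L \<le> 2 * v"
    using \<open>v \<ge> 1\<close> by (simp add: log1_def)
  then have "M * log1 L \<le> M * (2 * v)"
    using assms by (intro mult_left_mono) auto
  then show ?thesis by (simp add: L)
qed

lemma log1_square_le:
  assumes "M \<ge> 1"
  shows "(log1 M)\<^sup>2 \<le> 4 * M"
proof (cases "ln M \<ge> 1")
  case True
  have "ln M \<le> 2 * sqrt M"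
    using assms ln_bound[of "sqrt M"] by (simp add: ln_sqrt)
  then have "(ln M)\<^sup>2 \<le> (2 * sqrt M)\<^sup>2"
    using True by (intro power_mono) auto
  with True assms show ?thesis by (simp add: log1_def power_mult_distrib)
next
  case False
  with assms show ?thesis by (simp add: log1_def)
qed

lemma prod_primes_dvd:
  fixes N :: int
  assumes "\<And>p. p \<in> S \<Longrightarrow> prime p \<and> int p dvd N"
  shows "(\<Prod>p\<in>S. int p) dvd N"
proof -
  have "[N = 0] (mod (\<Prod>p\<in>S. int p))"
    using assms by (intro cong_cong_prod_coprime) (auto simp: cong_0_iff primes_coprime)
  then show ?thesis by (simp add: cong_0_iff)
qed

lemma log1_le_2_mult_ln:
  assumes "m < q" "q \<ge> 2"
  shows "log1 (real m) \<le> 2 * ln (real q)"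
proof -
  have "ln (real 2) \<le> ln (real q)"
    using assms(2) by (intro ln_mono) auto
  then have "1 \<le> 2 * ln (real q)"
    using ln2_ge_two_thirds by simp
  moreover have "ln (real m) \<le> ln (real q)"
    using assms by (cases "m = 0") auto
  ultimately show ?thesis
    by (auto simp: log1_def)
qed

lemma card_primes_gt_dvd_le:
  fixes N :: int
  assumes "finite Q" "\<And>q. q \<in> Q \<Longrightarrow> prime q" "N \<noteq> 0"
  shows "real (card {q \<in> Q. m < q \<and> int q dvd N}) * log1 (real m) \<le> 2 * ln (real_of_int \<bar>N\<bar>)"
proof -
  define S where "S = {q \<in> Q. m < q \<and> int q dvd N}"
  have S: "finite S" "\<And>q. q \<in> S \<Longrightarrow> q \<ge> 2"
    using assms(1,2) by (auto simp: S_def prime_ge_2_nat)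
  have "(\<Prod>q\<in>S. int q) dvd N"
    using assms(2) by (intro prod_primes_dvd) (auto simp: S_def)
  then have "(\<Prod>q\<in>S. int q) \<le> \<bar>N\<bar>"
    using assms(3) by (intro zdvd_imp_le) auto
  then have "real_of_int (\<Prod>q\<in>S. int q) \<le> real_of_int \<bar>N\<bar>"
    by (simp only: of_int_le_iff)
  then have prod_le: "(\<Prod>q\<in>S. real q) \<le> real_of_int \<bar>N\<bar>"
    by simp
  have "real (card S) * log1 (real m) \<le> (\<Sum>q\<in>S. 2 * ln (real q))"
    using S(2) by (intro sum_bounded_below log1_le_2_mult_ln) (auto simp: S_def)
  also have "\<dots> = 2 * ln (\<Prod>q\<in>S. real q)"
    using S by (subst ln_prod) (auto simp: sum_distrib_left dest: S(2))
  also have "\<dots> \<le> 2 * ln (real_of_int \<bar>N\<bar>)"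
    using prod_le S(2) by (intro mult_left_mono ln_mono prod_pos) force+
  finally show ?thesis by (simp add: S_def)
qed

section \<open>Averaging over the primes\<close>

lemma inj_on_ordered_triple:
  fixes f :: "'a \<Rightarrow> 'b :: linorder"
  assumes "card S = 3" "inj_on f S"
  obtains x y z where "S = {x, y, z}" "f x < f y" "f y < f z"
proof -
  obtain x y z where S: "S = {x, y, z}" and "x \<noteq> y" "y \<noteq> z" "x \<noteq> z"
    using assms(1) by (auto simp: card_3_iff)
  with assms(2) have "f x \<noteq> f y" "f y \<noteq> f z" "f x \<noteq> f z" by auto
  then consider "f x < f y" "f y < f z" | "f x < f z" "f z < f y" | "f y < f x" "f x < f z"
    | "f y < f z" "f z < f x" | "f z < f x" "f x < f y" | "f z < f y" "f y < f x"
    by (metis neqE)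
  then show thesis
    using that unfolding S by cases (metis insert_commute)+
qed

locale bohr_triple =
  fixes n :: nat and k h :: "nat \<Rightarrow> nat" and a :: "nat \<Rightarrow> int" and i j l m :: nat and A :: real
  assumes indices: "{i, j, l} \<subseteq> {1..n}"
    and k_less: "k i < k j" "k j < k l"
    and h_bounds: "v \<in> {i, j, l} \<Longrightarrow> 1 \<le> h v \<and> h v \<le> m"
    and a_bounds: "v \<in> {i, j, l} \<Longrightarrow> a v \<noteq> 0 \<and> real_of_int \<bar>a v\<bar> \<le> A"
begin

abbreviation U :: "nat \<Rightarrow> nat set" where
  "U q \<equiv> bohr_params n q a k h"

abbreviation logA :: real where "logA \<equiv> log1 A"
abbreviation logm :: real where "logm \<equiv> log1 (real m)"

definition cuboid :: "(int \<times> int \<times> int) set" where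
  "cuboid = punctured_interval (h i) \<times> punctured_interval (h j) \<times> punctured_interval (h l)"

definition form :: "int \<times> int \<times> int \<Rightarrow> int" where
  "form = triple_form (k j - k i) (k l - k j) (a i, a j, a l)"

definition nonzero_solutions :: "nat \<Rightarrow> (int \<times> int \<times> int) set" where
  "nonzero_solutions q = {x \<in> cuboid. form x \<noteq> 0 \<and> int q dvd form x}"

definition admissible :: "nat \<Rightarrow> bool" where
  "admissible q \<longleftrightarrow> prime q \<and> card {v \<in> {i, j, l}. int q dvd a v} \<le> 1"

lemma finite_cuboid: "finite cuboid"
  by (auto simp: cuboid_def)

lemma indices_distinct: "i \<noteq> j" "i \<noteq> l" "j \<noteq> l"
  using k_less by auto

lemma card_cuboid: "card cuboid = 8 * (\<Prod>v\<in>{i, j, l}. h v)"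
  using indices_distinct by (simp add: cuboid_def card_cartesian_product)

lemma m_ge_1: "m \<ge> 1"
  using h_bounds[of i] by simp

lemma A_ge_1: "A \<ge> 1"
proof -
  have "1 \<le> \<bar>a i\<bar>"
    using a_bounds[of i] by auto
  then have "1 \<le> real_of_int \<bar>a i\<bar>"
    by (simp only: of_int_1_le_iff)
  with a_bounds[of i] show ?thesis by simp
qed

lemma k_mult_m_mult_logm_ge_1: "1 \<le> real (k l) * (real m * logm)"
proof -
  have "1 * (1 * 1) \<le> real (k l) * (real m * logm)"
    using k_less m_ge_1 log1_ge_1 by (intro mult_mono) auto
  then show ?thesis by simp
qed

lemma admissible_card_U_le_pair:
  assumes "admissible q"
  shows "\<exists>v\<in>{i, j, l}. \<exists>w\<in>{i, j, l}. v \<noteq> w \<and> card (U q) \<le> 5 * k l * (h v * h w)"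
proof -
  let ?D = "{v \<in> {i, j, l}. int q dvd a v}"
  have "card ?D \<le> Suc 0" "finite ?D"
    using assms by (simp_all add: admissible_def)
  then have unique: "v = w"
    if "v \<in> {i, j, l}" "w \<in> {i, j, l}" "int q dvd a v" "int q dvd a w" for v w
    using that card_le_Suc0_iff_eq by blast
  have "\<exists>v\<in>{i, j, l}. \<exists>w\<in>{i, j, l}. k v < k w \<and> \<not> int q dvd a v \<and> \<not> int q dvd a w"
    using unique[of i j] unique[of i l] unique[of j l] k_less by fastforce
  then obtain v w where vw: "v \<in> {i, j, l}" "w \<in> {i, j, l}" "k v < k w"
    "\<not> int q dvd a v" "\<not> int q dvd a w" by blast
  then have "card (U q) \<le> 1 + (k w - k v) * (4 * (h v * h w))"
    using assms indices by (intro card_bohr_params_le_pair) (auto simp: admissible_def)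
  also have "\<dots> \<le> k l * (h v * h w) + k l * (4 * (h v * h w))"
  proof (rule add_mono)
    show "1 \<le> k l * (h v * h w)"
      using k_less h_bounds[OF vw(1)] h_bounds[OF vw(2)] by (simp add: Suc_le_eq)
    show "(k w - k v) * (4 * (h v * h w)) \<le> k l * (4 * (h v * h w))"
      using vw(2) k_less by (intro mult_right_mono) auto
  qed
  finally show ?thesis
    using vw(1-3) by (intro bexI[of _ v] bexI[of _ w]) (auto simp: algebra_simps)
qed

lemma admissible_card_U_le_square:
  assumes "admissible q"
  shows "card (U q) \<le> 5 * k l * (m * m)"
proof -
  obtain v w where vw: "v \<in> {i, j, l}" "w \<in> {i, j, l}" "card (U q) \<le> 5 * k l * (h v * h w)"
    using admissible_card_U_le_pair[OF assms] by blast
  note vw(3)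
  also have "5 * k l * (h v * h w) \<le> 5 * k l * (m * m)"
    using vw h_bounds by (intro mult_left_mono mult_mono) auto
  finally show ?thesis .
qed

lemma admissible_card_U_le_cuboid:
  assumes "admissible q"
  shows "card (U q) \<le> k l * card cuboid"
proof -
  obtain v w where vw: "v \<in> {i, j, l}" "w \<in> {i, j, l}" "v \<noteq> w"
    and U: "card (U q) \<le> 5 * k l * (h v * h w)"
    using admissible_card_U_le_pair[OF assms] by blast
  have "h i \<ge> 1" "h j \<ge> 1" "h l \<ge> 1"
    using h_bounds by auto
  then have "h v * h w \<le> h i * (h j * h l)"
    using vw by auto
  then have "5 * (h v * h w) \<le> card cuboid"
    using indices_distinct by (simp add: card_cuboid)
  then have "k l * (5 * (h v * h w)) \<le> k l * card cuboid"
    by (rule mult_le_mono2)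
  moreover have "5 * k l * (h v * h w) = k l * (5 * (h v * h w))" by simp
  ultimately show ?thesis using U by linarith
qed

lemma admissible_card_U_le_large_coeffs:
  assumes "admissible q" "logm * log1 logm \<le> logA"
  shows "real (card (U q)) \<le> 5 * real (k l) * (real m * exp (2 * (logA / log1 logA)))"
proof -
  have "logm \<le> 2 * (logA / log1 logA)"
    using mult_log1_le[OF log1_ge_1 assms(2)] by (simp add: field_simps)
  then have "exp (ln (real m)) \<le> exp (2 * (logA / log1 logA))"
    using ln_le_log1[of "real m"] unfolding exp_le_cancel_iff by linarith
  then have m_le: "real m \<le> exp (2 * (logA / log1 logA))"
    using m_ge_1 by simp
  have "real (card (U q)) \<le> real (5 * k l * (m * m))"
    using admissible_card_U_le_square[OF assms(1)] of_nat_mono by blast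
  also have "\<dots> = 5 * real (k l) * (real m * real m)" by simp
  also have "\<dots> \<le> 5 * real (k l) * (real m * exp (2 * (logA / log1 logA)))"
    using m_le by (intro mult_left_mono) auto
  finally show ?thesis .
qed

text \<open>
  The residues at which the form does not vanish are counted as triples because a nonzero value of
  the form has few prime factors \<open>q\<close>; the other ones satisfy no condition modulo \<open>q\<close> and are counted
  as pairs.
\<close>

lemma card_U_le_triple:
  assumes "prime q" "\<not> int q dvd a i * a j * a l"
  shows "real (card (U q)) \<le> 1 + real (k l) *
    (8 * (real m * (1 + ln (real m))) + real (card (nonzero_solutions q)))"
proof -
  define Z where "Z = {(v, w) \<in> punctured_interval m \<times> punctured_interval m.
    \<exists>y. y \<noteq> 0 \<and> form (v, y, w) = 0}"
  let ?B = "(\<lambda>(v, y, w). (v, w)) ` nonzero_solutions q"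
  have coprime: "\<not> int q dvd a i" "\<not> int q dvd a j" "\<not> int q dvd a l"
    using assms(2) by auto
  have "finite Z"
    by (rule finite_subset[of _ "punctured_interval m \<times> punctured_interval m"])
      (auto simp: Z_def)
  have fin: "finite (nonzero_solutions q)"
    using finite_cuboid by (simp add: nonzero_solutions_def)
  have "(x i, x l) \<in> Z \<union> ?B" if "\<not> q dvd u" and x: "x \<in> bohr_residues n q a k h u" for u x
  proof -
    have in_cuboid: "x i \<in> punctured_interval (h i)" "x j \<in> punctured_interval (h j)"
      "x l \<in> punctured_interval (h l)"
      using bohr_residues_in_punctured_interval[OF x] that(1) assms(1) coprime indices by auto
    have "int q dvd form (x i, x j, x l)"
      unfolding form_def using x indices k_less by (intro bohr_residues_dvd_triple_form) auto
    with in_cuboid h_bounds[of i] h_bounds[of l] show ?thesis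
      by (cases "form (x i, x j, x l) = 0")
        (force simp: Z_def in_punctured_interval_iff, force simp: nonzero_solutions_def cuboid_def)
  qed
  then have "card (U q) \<le> 1 + (k l - k i) * card (Z \<union> ?B)"
    using assms(1) coprime indices k_less \<open>finite Z\<close> fin
    by (intro card_bohr_params_le_mult_card) auto
  also have "\<dots> \<le> 1 + k l * (card Z + card (nonzero_solutions q))"
    using card_Un_le[of Z ?B] card_image_le[OF fin, of "\<lambda>(v, y, w). (v, w)"]
    by (intro add_left_mono mult_mono) auto
  finally have "real (card (U q)) \<le> real (1 + k l * (card Z + card (nonzero_solutions q)))"
    by (rule of_nat_mono)
  also have "\<dots> = 1 + real (k l) * (real (card Z) + real (card (nonzero_solutions q)))"
    by simp
  also have "real (card Z) \<le> 8 * (real m * (1 + ln (real m)))"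
    unfolding Z_def form_def using k_less a_bounds m_ge_1
    by (intro card_triple_form_zeros_le) auto
  finally show ?thesis
    by (simp add: mult_left_mono)
qed

lemma admissible_card_U_le:
  assumes "admissible q"
  shows "real (card (U q)) \<le> 17 * real (k l) * (real m * logm)
    + real (k l) * real (card cuboid) * of_bool (m < q \<and> int q dvd a i * a j * a l)
    + of_bool (m < q) * (real (k l) * real (card (nonzero_solutions q)))"
    (is "_ \<le> ?main + ?coeffs + ?form")
proof -
  have nonneg: "0 \<le> ?main" "0 \<le> ?coeffs" "0 \<le> ?form" by simp_all
  consider (small) "q \<le> m" | (dvd_coeffs) "m < q" "int q dvd a i * a j * a l"
    | (coprime) "m < q" "\<not> int q dvd a i * a j * a l"
    by linarith
  then show ?thesis
  proof cases
    case small
    have "real (card (U q)) \<le> 1 * (real m * 1)"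
      using card_bohr_params_le[of n q a k h] small by simp
    also have "\<dots> \<le> ?main"
      using k_less log1_ge_1 by (intro mult_mono) auto
    finally show ?thesis using nonneg by linarith
  next
    case dvd_coeffs
    then have "real (card (U q)) \<le> ?coeffs"
      using admissible_card_U_le_cuboid[OF assms] by (simp flip: of_nat_mult)
    then show ?thesis using nonneg by linarith
  next
    case coprime
    then have "real (card (U q)) \<le> 1 + real (k l) * (8 * (real m * (1 + ln (real m)))
        + real (card (nonzero_solutions q)))"
      using assms by (intro card_U_le_triple) (auto simp: admissible_def)
    also have "\<dots> = 1 + real (k l) * (8 * (real m * (1 + ln (real m)))) + ?form"
      using coprime by (simp add: distrib_left)
    also have "\<dots> \<le> 1 + real (k l) * (8 * (real m * (logm + logm))) + ?form"
      by (intro add_mono mult_left_mono) (simp_all add: ln_le_log1)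
    also have "\<dots> \<le> ?main + ?form"
      using k_mult_m_mult_logm_ge_1 by (simp add: algebra_simps)
    finally show ?thesis using nonneg by linarith
  qed
qed

lemma ln_abs_prod_coeffs_le: "ln (real_of_int \<bar>a i * a j * a l\<bar>) \<le> 3 * logA"
proof -
  have "ln (real_of_int \<bar>a v\<bar>) \<le> logA" if "v \<in> {i, j, l}" for v
  proof -
    have "ln (real_of_int \<bar>a v\<bar>) \<le> ln A"
      using a_bounds[OF that] by (intro ln_mono) auto
    also have "\<dots> \<le> logA" by (rule ln_le_log1)
    finally show ?thesis .
  qed
  from this[of i] this[of j] this[of l] show ?thesis
    using a_bounds by (simp add: abs_mult ln_mult)
qed

lemma ln_abs_form_le:
  assumes "x \<in> cuboid" "form x \<noteq> 0"
  shows "ln (real_of_int \<bar>form x\<bar>) \<le> 1 + real (k l) * (logA + logm)"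
proof -
  obtain x1 x2 x3 where x: "x = (x1, x2, x3)" by (cases x)
  have x_le: "\<bar>real_of_int y\<bar> \<le> real m" if "y \<in> punctured_interval (h v)" "v \<in> {i, j, l}" for y v
  proof -
    have "\<bar>y\<bar> \<le> int m"
      using that(1) h_bounds[OF that(2)] by (simp add: in_punctured_interval_iff)
    then have "real_of_int \<bar>y\<bar> \<le> real_of_int (int m)"
      by (simp only: of_int_le_iff)
    then show ?thesis by simp
  qed
  have "real_of_int \<bar>form x\<bar> = \<bar>triple_form (k j - k i) (k l - k j)
      (real_of_int (a i), real_of_int (a j), real_of_int (a l))
      (real_of_int x1, real_of_int x2, real_of_int x3)\<bar>"
    by (simp add: form_def triple_form_def x)
  also have "\<dots> \<le> 2 * (A * real m) ^ (k j - k i + (k l - k j))"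
    using assms(1) a_bounds x_le by (intro abs_triple_form_le) (auto simp: cuboid_def x)
  finally have "ln (real_of_int \<bar>form x\<bar>) \<le> ln (2 * (A * real m) ^ (k l - k i))"
    using assms(2) k_less by (intro ln_mono) auto
  also have "\<dots> = ln 2 + real (k l - k i) * (ln A + ln (real m))"
    using A_ge_1 m_ge_1 by (simp add: ln_mult ln_realpow)
  also have "\<dots> \<le> 1 + real (k l) * (logA + logm)"
    using A_ge_1 m_ge_1 ln_2_less_1 ln_le_log1 by (intro add_mono mult_mono) auto
  finally show ?thesis .
qed

end

locale bohr_average = bohr_triple +
  fixes Q :: "nat set"
  assumes finite_Q: "finite Q" and nonempty_Q: "Q \<noteq> {}"
    and admissible_Q: "q \<in> Q \<Longrightarrow> admissible q"
begin

lemma prime_Q: "q \<in> Q \<Longrightarrow> prime q"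
  using admissible_Q by (auto simp: admissible_def)

lemma card_Q_pos: "real (card Q) > 0"
  using finite_Q nonempty_Q by (simp add: card_gt_0_iff)

lemma card_primes_gt_m_dvd_le:
  assumes "N \<noteq> 0" "ln (real_of_int \<bar>N\<bar>) \<le> c * (logm * log1 logm)"
  shows "real (card {q \<in> Q. m < q \<and> int q dvd N}) \<le> 2 * c * log1 logm"
proof -
  have "real (card {q \<in> Q. m < q \<and> int q dvd N}) * logm \<le> 2 * ln (real_of_int \<bar>N\<bar>)"
    using finite_Q prime_Q assms(1) by (rule card_primes_gt_dvd_le)
  also have "\<dots> \<le> (2 * c * log1 logm) * logm"
    using assms(2) by (simp add: mult_ac)
  finally show ?thesis
    using log1_ge_1[of "real m"] by simp
qed

lemma card_primes_dvd_coeffs_le: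
  assumes "logA \<le> logm * log1 logm"
  shows "real (card {q \<in> Q. m < q \<and> int q dvd a i * a j * a l}) \<le> 6 * log1 logm"
  using card_primes_gt_m_dvd_le[of "a i * a j * a l" 3] ln_abs_prod_coeffs_le a_bounds assms by simp

lemma card_primes_dvd_form_le:
  assumes "logA \<le> logm * log1 logm" "x \<in> cuboid" "form x \<noteq> 0"
  shows "real (card {q \<in> Q. m < q \<and> int q dvd form x}) \<le> 6 * real (k l) * log1 logm"
proof -
  have logm_bounds: "logm \<le> logm * log1 logm" "1 \<le> logm * log1 logm"
    using log1_ge_1[of "real m"] log1_ge_1[of logm] mult_mono[of 1 logm 1 "log1 logm"] by auto
  have "ln (real_of_int \<bar>form x\<bar>) \<le> 1 * 1 + real (k l) * (logA + logm)"
    using ln_abs_form_le[OF assms(2,3)] by simp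
  also have "\<dots> \<le> real (k l) * (logm * log1 logm)
      + real (k l) * (logm * log1 logm + logm * log1 logm)"
    using assms(1) logm_bounds k_less by (intro add_mono mult_mono mult_left_mono) auto
  also have "\<dots> = (3 * real (k l)) * (logm * log1 logm)"
    by (simp add: algebra_simps)
  finally show ?thesis
    using card_primes_gt_m_dvd_le[OF assms(3)] by fastforce
qed

lemma sum_card_nonzero_solutions_le:
  assumes "logA \<le> logm * log1 logm"
  shows "(\<Sum>q\<in>{q \<in> Q. m < q}. real (card (nonzero_solutions q)))
    \<le> real (card cuboid) * (6 * real (k l) * log1 logm)"
proof -
  let ?Q = "{q \<in> Q. m < q}" and ?R = "\<lambda>q x. form x \<noteq> 0 \<and> int q dvd form x"
  have "(\<Sum>q\<in>?Q. real (card (nonzero_solutions q))) = (\<Sum>x\<in>cuboid. real (card {q \<in> ?Q. ?R q x}))"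
    unfolding of_nat_sum[symmetric] of_nat_eq_iff nonzero_solutions_def
    using finite_Q finite_cuboid by (intro sum_multicount_gen) auto
  also have "\<dots> \<le> (\<Sum>x\<in>cuboid. 6 * real (k l) * log1 logm)"
  proof (intro sum_mono)
    fix x assume "x \<in> cuboid"
    then show "real (card {q \<in> ?Q. ?R q x}) \<le> 6 * real (k l) * log1 logm"
      using card_primes_dvd_form_le[OF assms, of x] by (cases "form x = 0") (auto simp: conj_assoc)
  qed
  finally show ?thesis by simp
qed

lemma sum_card_U_le_small_coeffs:
  assumes "logA \<le> logm * log1 logm"
  shows "(\<Sum>q\<in>Q. real (card (U q))) \<le> real (card Q) * (17 * real (k l) * (real m * logm))
    + 12 * (real (k l))\<^sup>2 * (real (card cuboid) * log1 logm)"
proof -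
  let ?divides = "\<lambda>q. m < q \<and> int q dvd a i * a j * a l"
  have "(\<Sum>q\<in>Q. real (card (U q))) \<le> (\<Sum>q\<in>Q. 17 * real (k l) * (real m * logm)
      + real (k l) * real (card cuboid) * of_bool (?divides q)
      + of_bool (m < q) * (real (k l) * real (card (nonzero_solutions q))))"
    by (intro sum_mono admissible_card_U_le admissible_Q)
  also have "\<dots> = real (card Q) * (17 * real (k l) * (real m * logm))
      + real (k l) * real (card cuboid) * real (card {q \<in> Q. ?divides q})
      + real (k l) * (\<Sum>q\<in>{q \<in> Q. m < q}. real (card (nonzero_solutions q)))"
    using finite_Q by (simp add: sum.distrib Int_def flip: sum_distrib_left)
  also have "\<dots> \<le> real (card Q) * (17 * real (k l) * (real m * logm))
      + real (k l) * real (card cuboid) * (6 * log1 logm)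
      + real (k l) * (real (card cuboid) * (6 * real (k l) * log1 logm))"
    using card_primes_dvd_coeffs_le[OF assms] sum_card_nonzero_solutions_le[OF assms]
    by (intro add_mono mult_left_mono) auto
  also have "\<dots> = real (card Q) * (17 * real (k l) * (real m * logm))
      + 6 * (real (k l) + (real (k l))\<^sup>2) * (real (card cuboid) * log1 logm)"
    by (simp add: algebra_simps power2_eq_square)
  also have "6 * (real (k l) + (real (k l))\<^sup>2) * (real (card cuboid) * log1 logm)
      \<le> 12 * (real (k l))\<^sup>2 * (real (card cuboid) * log1 logm)"
    using k_less self_le_power[of "real (k l)" 2] by (intro mult_right_mono) auto
  finally show ?thesis by simp
qed

definition main_term :: real where
  "main_term = real m * exp (2 * (logA / log1 logA + log1 logm))"

definition error_term :: real where
  "error_term = (\<Prod>v\<in>{i, j, l}. real (h v)) * logm / (real (card Q) * log1 logm)"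

lemma average_card_U_le_large_coeffs:
  assumes "logm * log1 logm \<le> logA"
  shows "(\<Sum>q\<in>Q. real (card (U q))) / real (card Q) \<le> 5 * real (k l) * main_term"
proof -
  have "(\<Sum>q\<in>Q. real (card (U q)))
      \<le> (\<Sum>q\<in>Q. 5 * real (k l) * (real m * exp (2 * (logA / log1 logA))))"
    using assms by (intro sum_mono admissible_card_U_le_large_coeffs admissible_Q)
  also have "\<dots> \<le> (\<Sum>q\<in>Q. 5 * real (k l) * main_term)"
    unfolding main_term_def using log1_ge_1[of logm] by (intro sum_mono mult_left_mono) auto
  finally show ?thesis
    using card_Q_pos by (simp add: field_simps)
qed

lemma average_card_U_le_small_coeffs:
  assumes "logA \<le> logm * log1 logm"
  shows "(\<Sum>q\<in>Q. real (card (U q))) / real (card Q)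
    \<le> 17 * real (k l) * main_term + 384 * (real (k l))\<^sup>2 * error_term"
proof -
  have "0 \<le> logA / log1 logA" by simp
  then have "ln logm \<le> 2 * (logA / log1 logA + log1 logm)"
    using ln_le_log1[of logm] log1_pos[of logm] unfolding distrib_left by linarith
  then have "exp (ln logm) \<le> exp (2 * (logA / log1 logA + log1 logm))"
    by (simp only: exp_le_cancel_iff)
  then have main: "real m * logm \<le> main_term"
    unfolding main_term_def by (intro mult_left_mono) auto
  have "log1 logm \<le> 4 * (logm / log1 logm)"
    using log1_square_le[of logm] by (simp add: power2_eq_square field_simps)
  then have "real (card cuboid) * log1 logm / real (card Q)
      \<le> real (card cuboid) * (4 * (logm / log1 logm)) / real (card Q)"
    by (intro divide_right_mono mult_left_mono) auto
  also have "\<dots> = 32 * error_term"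
    by (simp add: error_term_def card_cuboid mult_ac)
  finally have error: "real (card cuboid) * log1 logm / real (card Q) \<le> 32 * error_term" .
  have "(\<Sum>q\<in>Q. real (card (U q))) / real (card Q)
      \<le> 17 * real (k l) * (real m * logm)
        + 12 * (real (k l))\<^sup>2 * (real (card cuboid) * log1 logm / real (card Q))"
    using sum_card_U_le_small_coeffs[OF assms] card_Q_pos by (simp add: field_simps)
  also have "\<dots> \<le> 17 * real (k l) * main_term + 12 * (real (k l))\<^sup>2 * (32 * error_term)"
    using main error by (intro add_mono mult_left_mono) auto
  finally show ?thesis by simp
qed

lemma average_card_U_le:
  "(\<Sum>q\<in>Q. real (card (U q))) / real (card Q) \<le> 384 * (real (k l))\<^sup>2 * (main_term + error_term)"
proof -
  have nonneg: "0 \<le> main_term" "0 \<le> error_term"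
    by (simp_all add: main_term_def error_term_def prod_nonneg)
  have "(\<Sum>q\<in>Q. real (card (U q))) / real (card Q)
      \<le> 17 * real (k l) * main_term + 384 * (real (k l))\<^sup>2 * error_term"
  proof (cases "logm * log1 logm \<le> logA")
    case True
    have "5 * real (k l) * main_term \<le> 17 * real (k l) * main_term"
      using nonneg by (intro mult_right_mono) auto
    moreover have "0 \<le> 384 * (real (k l))\<^sup>2 * error_term"
      using nonneg by simp
    ultimately show ?thesis
      using average_card_U_le_large_coeffs[OF True] by linarith
  qed (use average_card_U_le_small_coeffs in simp)
  also have "17 * real (k l) * main_term \<le> 384 * (real (k l))\<^sup>2 * main_term"
    using nonneg k_less self_le_power[of "real (k l)" 2] by (intro mult_right_mono mult_mono) auto
  finally show ?thesis by (simp add: distrib_left)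
qed

end

theorem theorem2p3:
  fixes n :: nat and k :: "nat \<Rightarrow> nat"
  assumes "n \<ge> 3"
    and "\<forall>i\<in>{1..n}. k i > 0"
    and "inj_on k {1..n}"
  shows "\<exists>C>0::real. \<exists>c>0::real.
    \<forall>(h :: nat \<Rightarrow> nat) (A :: real) (a :: nat \<Rightarrow> int) (Q :: nat set).
      1 \<le> h 1 \<longrightarrow> mono_on {1..n} h \<longrightarrow>
      (\<forall>i\<in>{1..n}. 0 < \<bar>a i\<bar> \<and> real_of_int \<bar>a i\<bar> \<le> A) \<longrightarrow>
      finite Q \<longrightarrow> Q \<noteq> {} \<longrightarrow> (\<forall>q\<in>Q. prime q) \<longrightarrow>
      (\<forall>q\<in>Q. card {i \<in> {1..3}. int q dvd a i} \<le> 1) \<longrightarrow>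
      (\<Sum>q\<in>Q. real (card (bohr_params n q a k h))) / real (card Q)
        \<le> C * (real (h 3) * exp (c * (log1 A / log1 (log1 A) + log1 (log1 (real (h 3)))))
             + real (h 1) * real (h 2) * real (h 3) * log1 (real (h 3))
               / (real (card Q) * log1 (log1 (real (h 3)))))"
proof -
  have "inj_on k {1..3}"
    using assms(1,3) by (auto intro: inj_on_subset)
  then obtain i j l where ijl: "{1..3} = {i, j, l}" and k: "k i < k j" "k j < k l"
    using inj_on_ordered_triple[of "{1..3}" k] by auto
  have C: "384 * (real (k l))\<^sup>2 > 0" using k by simp
  show ?thesis
  proof (rule exI[of _ "384 * (real (k l))\<^sup>2"], intro exI[of _ "2 :: real"] conjI C allI impI)
    fix h :: "nat \<Rightarrow> nat" and A :: real and a :: "nat \<Rightarrow> int" and Q :: "nat set"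
    assume h: "1 \<le> h 1" "mono_on {1..n} h"
      and a: "\<forall>i\<in>{1..n}. 0 < \<bar>a i\<bar> \<and> real_of_int \<bar>a i\<bar> \<le> A"
      and Q: "finite Q" "Q \<noteq> {}" "\<forall>q\<in>Q. prime q" "\<forall>q\<in>Q. card {i \<in> {1..3}. int q dvd a i} \<le> 1"
    have h_bounds: "1 \<le> h v \<and> h v \<le> h 3" if "v \<in> {1..3}" for v
      using that assms(1) h mono_onD[OF h(2), of 1 v] mono_onD[OF h(2), of v 3] by auto
    interpret bohr_triple n k h a i j l "h 3" A
      using assms(1) a k h_bounds by unfold_locales (auto simp flip: ijl)
    interpret bohr_average n k h a i j l "h 3" A Q
      using Q by unfold_locales (auto simp: admissible_def simp flip: ijl)
    have "(\<Prod>v\<in>{1..3}. real (h v)) = real (h 1) * real (h 2) * real (h 3)"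
      by (simp add: numeral_eq_Suc)
    then show "(\<Sum>q\<in>Q. real (card (bohr_params n q a k h))) / real (card Q)
        \<le> 384 * (real (k l))\<^sup>2 *
          (real (h 3) * exp (2 * (log1 A / log1 (log1 A) + log1 (log1 (real (h 3)))))
             + real (h 1) * real (h 2) * real (h 3) * log1 (real (h 3))
               / (real (card Q) * log1 (log1 (real (h 3)))))"
      using average_card_U_le unfolding main_term_def error_term_def ijl[symmetric] by simp
  qed simp
qed

end
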